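(* Let $G$ and $H$ be connected graphs of orders $m$ and $n$, respectively. For every integer $k \ge 1$, $$d_k(G \Box H) \le \min\{\, m\, d_k(H),\ n\, d_k(G) \,\}.$$
   Context: $G \Box H$ is the Cartesian product: vertex set $V(G)\times V(H)$, with $(x,y)$ adjacent to $(u,v)$ iff ($x=u$ and $yv \in E(H)$) or ($xu \in E(G)$ and $y=v$). The $k$-move deduction game ($k$ a positive integer) on a finite graph $G$: a layout places a finite number of searchers on vertices of $G$ (several searchers may share a vertex). Every searcher is initially mobile. A vertex is protected once it has been occupied by some searcher (so initially occupied vertices are protected); other vertices are unprotected. The game proceeds in stages. At each stage, for every vertex $v$ that has at least one unprotected neighbour: if the number of mobile searchers on $v$ is at least the number of unprotected neighbours of $v$, then the mobile searchers on $v$ move to the unprotected neighbours of $v$ so that each unprotected neighbour receives at least one searcher; excess mobile searchers on $v$ may also move to any of these unprotected neighbours. All moves in a stage happen simultaneously, newly occupied vertices become protected, and a searcher that has moved $k$ times becomes immobile. The process repeats until all vertices are protected or no searcher can move. A layout is successful if all vertices of $G$ end up protected. The $k$-move deduction number $d_k(G)$ is the minimum number of searchers in a successful layout on $G$. *)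

theory Defs
  imports "Graph_Theory.Graph_Theory"
begin

text \<open>
  A finite simple graph is a \<open>pair_graph\<close> (a finite, loop-free, symmetric relation of arcs, an
  undirected edge \<open>uv\<close> being the two arcs \<open>(u, v)\<close> and \<open>(v, u)\<close>).
\<close>

definition cartesian_product ::
  "'a pair_pre_digraph \<Rightarrow> 'b pair_pre_digraph \<Rightarrow> ('a \<times> 'b) pair_pre_digraph"
  (infixl \<open>\<box>\<close> 75) where
  "G \<box> H =
    \<lparr> pverts = pverts G \<times> pverts H,
      parcs = {((x, y), (u, v)) | x y u v.
        (x = u \<and> x \<in> pverts G \<and> (y, v) \<in> parcs H) \<or>
        ((x, u) \<in> parcs G \<and> y = v \<and> y \<in> pverts H)} \<rparr>"

lemma pair_graph_cartesian_product:
  assumes "pair_graph G" and "pair_graph H"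
  shows "pair_graph (G \<box> H)"
proof -
  interpret G: pair_graph G by fact
  interpret H: pair_graph H by fact
  have arcs: "parcs (G \<box> H) \<subseteq> pverts (G \<box> H) \<times> pverts (G \<box> H)"
    by (auto simp: cartesian_product_def dest: G.in_arcsD1 G.in_arcsD2 H.in_arcsD1 H.in_arcsD2)
  have fin: "finite (pverts (G \<box> H))"
    by (simp add: cartesian_product_def)
  have "sym (parcs G)" "sym (parcs H)"
    using G.sym_arcs H.sym_arcs by (auto simp: symmetric_def)
  then have "symmetric (with_proj (G \<box> H))"
    by (auto simp: symmetric_def cartesian_product_def sym_def)
  moreover have "fst e \<noteq> snd e" if "e \<in> parcs (G \<box> H)" for e
    using that G.pair_no_loops H.pair_no_loops by (fastforce simp: cartesian_product_def)
  ultimately show ?thesis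
    using arcs fin by unfold_locales (auto intro: finite_subset)
qed

text \<open>
  The searchers are numbered \<open>0, \<dots>, s - 1\<close>; the values of \<open>pos\<close> and \<open>moves\<close> at other arguments
  are irrelevant. \<open>moves \<sigma> i\<close> counts how often searcher \<open>i\<close> has moved so far.
\<close>

record 'a deduction_state =
  pos :: "nat \<Rightarrow> 'a"
  moves :: "nat \<Rightarrow> nat"
  protected :: "'a set"

definition initial_state :: "nat \<Rightarrow> (nat \<Rightarrow> 'a) \<Rightarrow> 'a deduction_state" where
  "initial_state s L = \<lparr> pos = L, moves = (\<lambda>_. 0), protected = L ` {..<s} \<rparr>"

definition unprotected_nbrs :: "'a pair_pre_digraph \<Rightarrow> 'a deduction_state \<Rightarrow> 'a \<Rightarrow> 'a set" where
  "unprotected_nbrs G \<sigma> v = {u. (v, u) \<in> parcs G \<and> u \<notin> protected \<sigma>}"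

definition mobile_on :: "nat \<Rightarrow> nat \<Rightarrow> 'a deduction_state \<Rightarrow> 'a \<Rightarrow> nat set" where
  "mobile_on k s \<sigma> v = {i. i < s \<and> pos \<sigma> i = v \<and> moves \<sigma> i < k}"

definition fires :: "nat \<Rightarrow> 'a pair_pre_digraph \<Rightarrow> nat \<Rightarrow> 'a deduction_state \<Rightarrow> 'a \<Rightarrow> bool" where
  "fires k G s \<sigma> v \<longleftrightarrow>
     v \<in> pverts G \<and> unprotected_nbrs G \<sigma> v \<noteq> {} \<and>
     card (unprotected_nbrs G \<sigma> v) \<le> card (mobile_on k s \<sigma> v)"

text \<open>
  One stage. All vertices that can fire must do so simultaneously, as judged in the old state
  \<open>\<sigma>\<close>; \<open>A\<close> is the set of searchers that move. The relation is not functional: which mobile searcher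
  goes to which neighbour, and whether and where the excess searchers move, is left open.
  If no vertex fires, then no searcher moves and nothing becomes protected.
\<close>

definition stage ::
  "nat \<Rightarrow> 'a pair_pre_digraph \<Rightarrow> nat \<Rightarrow> 'a deduction_state \<Rightarrow> 'a deduction_state \<Rightarrow> bool" where
  "stage k G s \<sigma> \<sigma>' \<longleftrightarrow>
    (\<exists>A \<subseteq> {..<s}.
      (\<forall>i\<in>A. fires k G s \<sigma> (pos \<sigma> i) \<and> i \<in> mobile_on k s \<sigma> (pos \<sigma> i) \<and>
              pos \<sigma>' i \<in> unprotected_nbrs G \<sigma> (pos \<sigma> i) \<and>
              moves \<sigma>' i = Suc (moves \<sigma> i)) \<and>
      (\<forall>i\<in>{..<s} - A. pos \<sigma>' i = pos \<sigma> i \<and> moves \<sigma>' i = moves \<sigma> i) \<and>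
      (\<forall>v. fires k G s \<sigma> v \<longrightarrow>
              (\<forall>u \<in> unprotected_nbrs G \<sigma> v. \<exists>i\<in>A. pos \<sigma> i = v \<and> pos \<sigma>' i = u)) \<and>
      protected \<sigma>' = protected \<sigma> \<union> pos \<sigma>' ` {..<s})"

definition layout :: "'a pair_pre_digraph \<Rightarrow> nat \<Rightarrow> (nat \<Rightarrow> 'a) \<Rightarrow> bool" where
  "layout G s L \<longleftrightarrow> (\<forall>i<s. L i \<in> pverts G)"

text \<open>
  A layout is successful if the searchers can choose their moves, within the freedom that a stage
  leaves them, so that all vertices end up protected. A state with all vertices protected is final.
\<close>

definition successful_layout :: "nat \<Rightarrow> 'a pair_pre_digraph \<Rightarrow> nat \<Rightarrow> (nat \<Rightarrow> 'a) \<Rightarrow> bool" where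
  "successful_layout k G s L \<longleftrightarrow> layout G s L \<and>
     (\<exists>\<sigma>. (stage k G s)\<^sup>*\<^sup>* (initial_state s L) \<sigma> \<and> protected \<sigma> = pverts G)"

definition deduction_number :: "nat \<Rightarrow> 'a pair_pre_digraph \<Rightarrow> nat" where
  "deduction_number k G = (LEAST s. \<exists>L. successful_layout k G s L)"

lemma ex_successful_layout:
  assumes "finite (pverts G)"
  shows "\<exists>L. successful_layout k G (card (pverts G)) L"
proof -
  obtain L where L: "bij_betw L {..<card (pverts G)} (pverts G)"
    using ex_bij_betw_nat_finite[OF assms] by (auto simp: atLeast0LessThan)
  then have "successful_layout k G (card (pverts G)) L"
    unfolding successful_layout_def layout_def
    by (auto simp: initial_state_def bij_betw_def intro!: exI[of _ "initial_state (card (pverts G)) L"])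
  then show ?thesis by blast
qed

lemma deduction_number_attained:
  assumes "finite (pverts G)"
  shows "\<exists>L. successful_layout k G (deduction_number k G) L"
  unfolding deduction_number_def by (rule LeastI) (rule ex_successful_layout[OF assms])

end

theory Submission
  imports Defs
begin

text \<open>
  Put a copy of an optimal layout of \<open>H\<close> on each of the \<open>m\<close> copies of \<open>H\<close> in \<open>G \<box> H\<close> and let all
  copies play the same moves in lockstep. The protected set then always has the form
  \<open>V(G) \<times> P\<close>, so an occupied vertex \<open>(x, y)\<close> has no unprotected neighbour outside its own copy
  of \<open>H\<close>, and it fires exactly when \<open>y\<close> fires in \<open>H\<close>. The other bound is the same argument for
  the copies of \<open>G\<close>.
\<close>

text \<open>
  Stated abstractly so as to apply to both the copies of \<open>H\<close> and the copies of \<open>G\<close> in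
  \<open>G \<box> H\<close>; the \<open>j\<close>-th copy is the image of \<open>e j\<close>.
\<close>

locale copies_of =
  fixes K :: "'c pair_pre_digraph" and H :: "'b pair_pre_digraph"
    and m :: nat and e :: "nat \<Rightarrow> 'b \<Rightarrow> 'c"
  assumes finite_H: "finite (pverts H)"
    and arcs_H: "parcs H \<subseteq> pverts H \<times> pverts H"
    and arcs_K: "parcs K \<subseteq> pverts K \<times> pverts K"
    and verts_K: "pverts K = case_prod e ` ({..<m} \<times> pverts H)"
    and inj_e: "inj_on (case_prod e) ({..<m} \<times> pverts H)"
    and arc_same_copy: "\<And>j y z. j < m \<Longrightarrow> y \<in> pverts H \<Longrightarrow> z \<in> pverts H \<Longrightarrow>
      (e j y, e j z) \<in> parcs K \<longleftrightarrow> (y, z) \<in> parcs H"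
    and arc_other_copy: "\<And>i j y z. i < m \<Longrightarrow> j < m \<Longrightarrow> i \<noteq> j \<Longrightarrow>
      y \<in> pverts H \<Longrightarrow> z \<in> pverts H \<Longrightarrow> (e i y, e j z) \<in> parcs K \<Longrightarrow> y = z"
begin

section \<open>Vertices of the copies and the lockstep state\<close>

lemma e_eq_iff:
  assumes "i < m" "j < m" "y \<in> pverts H" "z \<in> pverts H"
  shows "e i y = e j z \<longleftrightarrow> i = j \<and> y = z"
  using inj_onD[OF inj_e, of "(i, y)" "(j, z)"] assms by auto

lemma vert_K_cases:
  assumes "v \<in> pverts K"
  obtains j y where "j < m" "y \<in> pverts H" "v = e j y"
  using assms unfolding verts_K by auto

lemma e_in_verts_K: "j < m \<Longrightarrow> y \<in> pverts H \<Longrightarrow> e j y \<in> pverts K"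
  unfolding verts_K by (auto intro: image_eqI[where x = "(j, y)"])

lemma finite_K: "finite (pverts K)"
  unfolding verts_K using finite_H by auto

text \<open>The searchers come in \<open>m\<close> blocks of length \<open>s\<close>:
  \<open>i div s\<close> is the copy in which searcher \<open>i\<close> lives, and
  \<open>i mod s\<close> is the searcher on \<open>H\<close> that it imitates.\<close>

definition copy_state :: "nat \<Rightarrow> 'b deduction_state \<Rightarrow> 'c deduction_state" where
  "copy_state s \<sigma> =
    \<lparr> pos = (\<lambda>i. e (i div s) (pos \<sigma> (i mod s))),
      moves = (\<lambda>i. moves \<sigma> (i mod s)),
      protected = case_prod e ` ({..<m} \<times> protected \<sigma>) \<rparr>"

lemma copy_state_simps [simp]:
  "pos (copy_state s \<sigma>) i = e (i div s) (pos \<sigma> (i mod s))"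
  "moves (copy_state s \<sigma>) i = moves \<sigma> (i mod s)"
  "protected (copy_state s \<sigma>) = case_prod e ` ({..<m} \<times> protected \<sigma>)"
  by (simp_all add: copy_state_def)

text \<open>The invariant of play on \<open>H\<close>. Positions inside \<open>pverts H\<close> make
  the injectivity of \<open>e\<close> applicable; protected positions keep searchers from leaving
  their copy.\<close>

definition consistent :: "nat \<Rightarrow> 'b deduction_state \<Rightarrow> bool" where
  "consistent s \<sigma> \<longleftrightarrow> protected \<sigma> \<subseteq> pverts H \<and> pos \<sigma> ` {..<s} \<subseteq> protected \<sigma>"

lemma consistent_pos:
  assumes "consistent s \<sigma>" "i < s"
  shows "pos \<sigma> i \<in> protected \<sigma>" "pos \<sigma> i \<in> pverts H"
  using assms unfolding consistent_def by auto

section \<open>Numbering of the searchers\<close>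

lemma index_bounds:
  fixes i s :: nat
  assumes "i < m * s"
  shows "i div s < m" "i mod s < s"
proof -
  \<comment> \<open>\<open>i mod 0 = i\<close>, so \<open>s = 0\<close> has to be excluded; the
    premise is then false.\<close>
  have "0 < s" using assms by (cases s) auto
  then show "i div s < m" "i mod s < s" using assms by (simp_all add: less_mult_imp_div_less)
qed

lemma index_less:
  fixes i j s :: nat
  assumes "j < m" "i < s"
  shows "j * s + i < m * s"
proof -
  have "j * s + i < Suc j * s" using assms by simp
  also have "\<dots> \<le> m * s" using assms by (intro mult_le_mono1) simp
  finally show ?thesis .
qed

text \<open>Division with remainder identifies \<open>{..<m * s}\<close> with pairs of a copy and a
  searcher. This gives the product form of the protected set, both initially and after a
  stage.\<close>

lemma image_positions:
  "(\<lambda>i. e (i div s) (f (i mod s))) ` {..<m * s} = case_prod e ` ({..<m} \<times> f ` {..<s})"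
proof (intro subset_antisym subsetI)
  fix v assume "v \<in> (\<lambda>i. e (i div s) (f (i mod s))) ` {..<m * s}"
  then obtain i where "i < m * s" "v = e (i div s) (f (i mod s))" by auto
  then show "v \<in> case_prod e ` ({..<m} \<times> f ` {..<s})"
    using index_bounds[of i s] by (intro image_eqI[where x = "(i div s, f (i mod s))"]) auto
next
  fix v assume "v \<in> case_prod e ` ({..<m} \<times> f ` {..<s})"
  then obtain j i where "j < m" "i < s" "v = e j (f i)" by auto
  then show "v \<in> (\<lambda>i. e (i div s) (f (i mod s))) ` {..<m * s}"
    using index_less by (intro image_eqI[where x = "j * s + i"]) auto
qed

lemma copy_initial_state:
  "copy_state s (initial_state s L) = initial_state (m * s) (\<lambda>i. e (i div s) (L (i mod s)))"
  by (simp add: copy_state_def initial_state_def image_positions)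

lemma consistent_initial_state:
  "layout H s L \<Longrightarrow> consistent s (initial_state s L)"
  by (auto simp: consistent_def initial_state_def layout_def)

section \<open>One stage, played in all copies\<close>

lemma consistent_stage:
  assumes "stage k H s \<sigma> \<sigma>'" "consistent s \<sigma>"
  shows "consistent s \<sigma>'"
proof -
  have "unprotected_nbrs H \<sigma> y \<subseteq> pverts H" for y
    using arcs_H by (auto simp: unprotected_nbrs_def)
  moreover have "pos \<sigma>' i = pos \<sigma> i \<or> pos \<sigma>' i \<in> unprotected_nbrs H \<sigma> (pos \<sigma> i)" if "i < s" for i
    using assms(1) that unfolding stage_def by blast
  ultimately have "pos \<sigma>' i \<in> pverts H" if "i < s" for i
    using consistent_pos(2)[OF assms(2) that] that by (metis subsetD)
  then show ?thesis
    using assms unfolding stage_def consistent_def by auto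
qed

text \<open>Arcs between different copies join counterparts of the same vertex of \<open>H\<close>,
  and all counterparts of a protected \<open>y\<close> are protected. So only neighbours in the same
  copy can be unprotected.\<close>

lemma unprotected_nbrs_copy:
  assumes "consistent s \<sigma>" "j < m" "y \<in> protected \<sigma>"
  shows "unprotected_nbrs K (copy_state s \<sigma>) (e j y) = e j ` unprotected_nbrs H \<sigma> y"
proof -
  have sub: "protected \<sigma> \<subseteq> pverts H" and y: "y \<in> pverts H"
    using assms by (auto simp: consistent_def)
  have protected_iff: "e i z \<in> protected (copy_state s \<sigma>) \<longleftrightarrow> z \<in> protected \<sigma>"
    if "i < m" "z \<in> pverts H" for i z
    using that sub e_eq_iff by (fastforce simp: image_iff)
  show ?thesis
  proof (intro subset_antisym subsetI)
    fix v assume v: "v \<in> unprotected_nbrs K (copy_state s \<sigma>) (e j y)"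
    then have arc: "(e j y, v) \<in> parcs K" by (simp add: unprotected_nbrs_def)
    then have "v \<in> pverts K" using arcs_K by auto
    then obtain i z where iz: "i < m" "z \<in> pverts H" "v = e i z" by (rule vert_K_cases)
    have z: "z \<notin> protected \<sigma>"
      using v iz protected_iff unfolding unprotected_nbrs_def by blast
    \<comment> \<open>Here \<open>y\<close> is protected and \<open>z\<close> is not, so
      \<open>y \<noteq> z\<close>, which \<open>arc_other_copy\<close> forbids between different
      copies.\<close>
    then have "i = j"
      using arc_other_copy[of j i y z] arc iz assms y by auto
    then show "v \<in> e j ` unprotected_nbrs H \<sigma> y"
      using arc iz z y arc_same_copy[of j y z] by (auto simp: unprotected_nbrs_def)
  next
    fix v assume "v \<in> e j ` unprotected_nbrs H \<sigma> y"
    then obtain z where z: "(y, z) \<in> parcs H" "z \<notin> protected \<sigma>" "v = e j z"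
      by (auto simp: unprotected_nbrs_def)
    moreover have "z \<in> pverts H" using z arcs_H by auto
    ultimately show "v \<in> unprotected_nbrs K (copy_state s \<sigma>) (e j y)"
      using protected_iff[of j z] arc_same_copy[of j y z] assms y
      unfolding unprotected_nbrs_def by blast
  qed
qed

text \<open>By injectivity of \<open>e\<close>, a searcher on \<open>e j y\<close> belongs to block
  \<open>j\<close>. The vertex \<open>y\<close> need not be protected, because
  \<open>fires_copyE\<close> uses this lemma to infer that it is.\<close>

lemma mobile_on_copy:
  assumes "consistent s \<sigma>" "j < m" "y \<in> pverts H"
  shows "mobile_on k (m * s) (copy_state s \<sigma>) (e j y) = (\<lambda>i. j * s + i) ` mobile_on k s \<sigma> y"
proof (intro subset_antisym subsetI)
  fix i assume i: "i \<in> mobile_on k (m * s) (copy_state s \<sigma>) (e j y)"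
  then have "i < m * s" by (simp add: mobile_on_def)
  note b = index_bounds[OF this]
  have "i div s = j" "pos \<sigma> (i mod s) = y"
    using i e_eq_iff[of "i div s" j "pos \<sigma> (i mod s)" y] b assms consistent_pos[OF assms(1) b(2)]
    by (auto simp: mobile_on_def)
  then show "i \<in> (\<lambda>i. j * s + i) ` mobile_on k s \<sigma> y"
    using i b by (intro image_eqI[where x = "i mod s"]) (auto simp: mobile_on_def)
next
  fix i assume "i \<in> (\<lambda>i. j * s + i) ` mobile_on k s \<sigma> y"
  then show "i \<in> mobile_on k (m * s) (copy_state s \<sigma>) (e j y)"
    using index_less[OF assms(2)] by (auto simp: mobile_on_def)
qed

text \<open>Both cardinalities compared in \<open>fires\<close> are preserved: \<open>e j\<close> is
  injective on \<open>pverts H\<close>, and so is the shift by \<open>j * s\<close> on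
  indices.\<close>

lemma fires_copy:
  assumes "consistent s \<sigma>" "j < m" "y \<in> protected \<sigma>"
  shows "fires k K (m * s) (copy_state s \<sigma>) (e j y) \<longleftrightarrow> fires k H s \<sigma> y"
proof -
  have y: "y \<in> pverts H" using assms by (auto simp: consistent_def)
  have "unprotected_nbrs H \<sigma> y \<subseteq> pverts H"
    using arcs_H by (auto simp: unprotected_nbrs_def)
  then have "inj_on (e j) (unprotected_nbrs H \<sigma> y)"
    using e_eq_iff[OF assms(2) assms(2)] by (intro inj_onI) (metis subsetD)
  then have "card (e j ` unprotected_nbrs H \<sigma> y) = card (unprotected_nbrs H \<sigma> y)"
    by (rule card_image)
  moreover have "card ((\<lambda>i. j * s + i) ` mobile_on k s \<sigma> y) = card (mobile_on k s \<sigma> y)"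
    by (rule card_image) simp
  ultimately show ?thesis
    unfolding fires_def unprotected_nbrs_copy[OF assms] mobile_on_copy[OF assms(1,2) y]
    using y e_in_verts_K assms(2) by simp
qed

text \<open>An unprotected vertex carries no searcher, so it cannot fire.\<close>

lemma fires_copyE:
  assumes "consistent s \<sigma>" "fires k K (m * s) (copy_state s \<sigma>) v"
  obtains j y where "j < m" "y \<in> protected \<sigma>" "v = e j y" "fires k H s \<sigma> y"
proof -
  let ?U = "unprotected_nbrs K (copy_state s \<sigma>) v"
  have "v \<in> pverts K" using assms(2) by (simp add: fires_def)
  then obtain j y where jy: "j < m" "y \<in> pverts H" "v = e j y" by (rule vert_K_cases)
  \<comment> \<open>An infinite set has \<open>card\<close> 0, so finiteness is what makes the
    nonempty \<open>?U\<close> demand at least one mobile searcher.\<close>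
  have "finite ?U"
    by (rule finite_subset[OF _ finite_K]) (use arcs_K in \<open>auto simp: unprotected_nbrs_def\<close>)
  then have "mobile_on k (m * s) (copy_state s \<sigma>) v \<noteq> {}"
    using assms(2) by (auto simp: fires_def)
  then obtain i where "i \<in> mobile_on k s \<sigma> y"
    using mobile_on_copy[OF assms(1) jy(1,2)] jy(3) by auto
  then have "y \<in> protected \<sigma>"
    using consistent_pos[OF assms(1), of i] by (auto simp: mobile_on_def)
  then show thesis
    using that[OF jy(1) _ jy(3)] fires_copy[OF assms(1) jy(1)] assms(2) jy(3) by simp
qed

lemma stage_copy:
  assumes "stage k H s \<sigma> \<sigma>'" "consistent s \<sigma>"
  shows "stage k K (m * s) (copy_state s \<sigma>) (copy_state s \<sigma>')"
proof -
  obtain A where A: "A \<subseteq> {..<s}"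
    and moving: "\<forall>i\<in>A. fires k H s \<sigma> (pos \<sigma> i) \<and> i \<in> mobile_on k s \<sigma> (pos \<sigma> i) \<and>
      pos \<sigma>' i \<in> unprotected_nbrs H \<sigma> (pos \<sigma> i) \<and> moves \<sigma>' i = Suc (moves \<sigma> i)"
    and resting: "\<forall>i\<in>{..<s} - A. pos \<sigma>' i = pos \<sigma> i \<and> moves \<sigma>' i = moves \<sigma> i"
    and covering: "\<forall>v. fires k H s \<sigma> v \<longrightarrow>
      (\<forall>u\<in>unprotected_nbrs H \<sigma> v. \<exists>i\<in>A. pos \<sigma> i = v \<and> pos \<sigma>' i = u)"
    and protected: "protected \<sigma>' = protected \<sigma> \<union> pos \<sigma>' ` {..<s}"
    using assms(1) unfolding stage_def by (elim exE conjE) (rule that)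
  let ?\<tau> = "copy_state s \<sigma>" and ?\<tau>' = "copy_state s \<sigma>'"
  \<comment> \<open>All imitators, one per copy, of the searchers that move on
    \<open>H\<close>.\<close>
  let ?B = "{i. i < m * s \<and> i mod s \<in> A}"
  have "fires k K (m * s) ?\<tau> (pos ?\<tau> i) \<and> i \<in> mobile_on k (m * s) ?\<tau> (pos ?\<tau> i) \<and>
      pos ?\<tau>' i \<in> unprotected_nbrs K ?\<tau> (pos ?\<tau> i) \<and> moves ?\<tau>' i = Suc (moves ?\<tau> i)"
    if i: "i \<in> ?B" for i
  proof -
    have "i < m * s" using i by simp
    note b = index_bounds[OF this]
    note p = consistent_pos(1)[OF assms(2) b(2)]
    show ?thesis
      using i b bspec[OF moving, of "i mod s"]
      by (simp add: fires_copy[OF assms(2) b(1) p] unprotected_nbrs_copy[OF assms(2) b(1) p]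
          mobile_on_def)
  qed
  moreover have "pos ?\<tau>' i = pos ?\<tau> i \<and> moves ?\<tau>' i = moves ?\<tau> i"
    if "i \<in> {..<m * s} - ?B" for i
    using that bspec[OF resting, of "i mod s"] index_bounds(2)[of i s] by simp
  moreover have "\<exists>i\<in>?B. pos ?\<tau> i = v \<and> pos ?\<tau>' i = u"
    if v: "fires k K (m * s) ?\<tau> v" and u: "u \<in> unprotected_nbrs K ?\<tau> v" for v u
  proof -
    obtain j y where jy: "j < m" "y \<in> protected \<sigma>" "v = e j y" "fires k H s \<sigma> y"
      using fires_copyE[OF assms(2) v] .
    then obtain z where z: "z \<in> unprotected_nbrs H \<sigma> y" "u = e j z"
      using u unprotected_nbrs_copy[OF assms(2) jy(1,2)] by auto
    obtain i where i: "i \<in> A" "pos \<sigma> i = y" "pos \<sigma>' i = z"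
      using covering jy(4) z(1) by blast
    then have "i < s" using A by auto
    then show ?thesis
      \<comment> \<open>The witness is the imitator of \<open>i\<close> in block
        \<open>j\<close>.\<close>
      using i jy z index_less[OF jy(1)] by (intro bexI[of _ "j * s + i"]) auto
  qed
  moreover have "protected ?\<tau>' = protected ?\<tau> \<union> pos ?\<tau>' ` {..<m * s}"
    using image_positions[of s "pos \<sigma>'"] protected by (simp add: Sigma_Un_distrib2 image_Un)
  ultimately show ?thesis
    unfolding stage_def by (intro exI[of _ ?B]) blast
qed

section \<open>Whole games and the resulting bound\<close>

lemma stages_copy:
  assumes "(stage k H s)\<^sup>*\<^sup>* \<sigma> \<sigma>'" "consistent s \<sigma>"
  shows "(stage k K (m * s))\<^sup>*\<^sup>* (copy_state s \<sigma>) (copy_state s \<sigma>')"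
proof -
  \<comment> \<open>The induction carries \<open>consistent\<close> along, since
    \<open>stage_copy\<close> requires it at every intermediate state.\<close>
  have "(stage k K (m * s))\<^sup>*\<^sup>* (copy_state s \<sigma>) (copy_state s \<sigma>') \<and> consistent s \<sigma>'"
    using assms
  proof (induction rule: rtranclp_induct)
    case base
    then show ?case by simp
  next
    case (step \<rho> \<rho>')
    then show ?case
      using consistent_stage stage_copy by (meson rtranclp.rtrancl_into_rtrancl)
  qed
  then show ?thesis ..
qed

lemma successful_layout_copy:
  assumes "successful_layout k H s L"
  shows "successful_layout k K (m * s) (\<lambda>i. e (i div s) (L (i mod s)))"
proof -
  obtain \<sigma> where \<sigma>: "layout H s L" "(stage k H s)\<^sup>*\<^sup>* (initial_state s L) \<sigma>"
    "protected \<sigma> = pverts H"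
    using assms by (auto simp: successful_layout_def)
  have "layout K (m * s) (\<lambda>i. e (i div s) (L (i mod s)))"
    using \<sigma>(1) index_bounds e_in_verts_K by (auto simp: layout_def)
  moreover have "(stage k K (m * s))\<^sup>*\<^sup>*
      (initial_state (m * s) (\<lambda>i. e (i div s) (L (i mod s)))) (copy_state s \<sigma>)"
    using stages_copy[OF \<sigma>(2) consistent_initial_state[OF \<sigma>(1)]] by (simp add: copy_initial_state)
  moreover have "protected (copy_state s \<sigma>) = pverts K"
    by (simp add: \<sigma>(3) verts_K)
  ultimately show ?thesis
    unfolding successful_layout_def by blast
qed

lemma deduction_number_le: "deduction_number k K \<le> m * deduction_number k H"
proof -
  obtain L where "successful_layout k H (deduction_number k H) L"
    using deduction_number_attained[OF finite_H] by blast
  then show ?thesis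
    unfolding deduction_number_def[of k K]
    by (blast intro: Least_le dest: successful_layout_copy)
qed

end

section \<open>The two families of copies in the product\<close>

lemma copies_of_cartesian_product:
  assumes "pair_graph G" "pair_graph H"
    and g: "bij_betw g {..<m} (pverts G)" and h: "bij_betw h {..<n} (pverts H)"
  shows copies_of_right_factor: "copies_of (G \<box> H) H m (\<lambda>j y. (g j, y))"
    and copies_of_left_factor: "copies_of (G \<box> H) G n (\<lambda>j x. (x, h j))"
proof -
  interpret G: pair_graph G by fact
  interpret H: pair_graph H by fact
  interpret GH: pair_graph "G \<box> H" by (rule pair_graph_cartesian_product) fact+
  have arcs: "parcs G \<subseteq> pverts G \<times> pverts G" "parcs H \<subseteq> pverts H \<times> pverts H"
    "parcs (G \<box> H) \<subseteq> pverts (G \<box> H) \<times> pverts (G \<box> H)"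
    by (auto dest: G.in_arcsD1 G.in_arcsD2 H.in_arcsD1 H.in_arcsD2 GH.in_arcsD1 GH.in_arcsD2)
  \<comment> \<open>Within one copy the fixed coordinate could change only along a loop; excluding
    loops leaves exactly the arcs of the copied factor.\<close>
  have no_loop: "(x, x) \<notin> parcs G" "(y, y) \<notin> parcs H" for x y
    using G.pair_no_loops H.pair_no_loops by fastforce+
  have verts: "pverts (G \<box> H) = pverts G \<times> pverts H"
    by (simp add: cartesian_product_def)
  have arc: "((x, y), (u, v)) \<in> parcs (G \<box> H) \<longleftrightarrow>
      (x = u \<and> x \<in> pverts G \<and> (y, v) \<in> parcs H) \<or> ((x, u) \<in> parcs G \<and> y = v \<and> y \<in> pverts H)"
    for x y u v
    by (simp add: cartesian_product_def)
  have gi: "inj_on g {..<m}" "pverts G = g ` {..<m}"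
    and hi: "inj_on h {..<n}" "pverts H = h ` {..<n}"
    using g h by (auto simp: bij_betw_def)
  show "copies_of (G \<box> H) H m (\<lambda>j y. (g j, y))"
  proof
    show "pverts (G \<box> H) = (\<lambda>(j, y). (g j, y)) ` ({..<m} \<times> pverts H)"
      unfolding verts gi(2) by auto
    show "inj_on (\<lambda>(j, y). (g j, y)) ({..<m} \<times> pverts H)"
      using gi(1) by (auto simp: inj_on_def)
  qed (use arcs gi no_loop in \<open>auto simp: arc inj_on_def\<close>)
  show "copies_of (G \<box> H) G n (\<lambda>j x. (x, h j))"
  proof
    show "pverts (G \<box> H) = (\<lambda>(j, x). (x, h j)) ` ({..<n} \<times> pverts G)"
      unfolding verts hi(2) by auto
    show "inj_on (\<lambda>(j, x). (x, h j)) ({..<n} \<times> pverts G)"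
      using hi(1) by (auto simp: inj_on_def)
  qed (use arcs hi no_loop in \<open>auto simp: arc inj_on_def\<close>)
qed

theorem theorem4p2:
  fixes G :: "'a pair_pre_digraph" and H :: "'b pair_pre_digraph" and m n k :: nat
  assumes "pair_graph G" and "connected (with_proj G)" and "card (pverts G) = m"
    and "pair_graph H" and "connected (with_proj H)" and "card (pverts H) = n"
    and "k \<ge> 1"
  shows "deduction_number k (G \<box> H) \<le> min (m * deduction_number k H) (n * deduction_number k G)"
proof -
  interpret G: pair_graph G by fact
  interpret H: pair_graph H by fact
  obtain g h where "bij_betw g {..<m} (pverts G)" "bij_betw h {..<n} (pverts H)"
    using ex_bij_betw_nat_finite[of "pverts G"] ex_bij_betw_nat_finite[of "pverts H"] assms(3,6)
    by (auto simp: atLeast0LessThan)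
  note copies = copies_of_cartesian_product[OF assms(1,4) this]
  show ?thesis
    using copies_of.deduction_number_le[OF copies(1)] copies_of.deduction_number_le[OF copies(2)]
    by simp
qed

end
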